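(* Let $e$ be a prime with $e\equiv 1\pmod 4$. Suppose $u$ is an integer such that (1) $u$ is odd and $u^2\equiv -1\pmod e$, and (2) $u\equiv 2^l c^2 r\pm 1 \pmod{2^{l+1}c^2 e}$ for some integers $c>0$, $l\ge 0$ and $r$ with $2\mid 2^l c$, $r$ odd, and $r$ a quadratic non-residue modulo $e$ (i.e. $e\nmid r$ and $r$ is not congruent to a square modulo $e$). Then there is no binary sequence $\mathbf a$ of period $n=\tfrac12(u^2+1)$ with $C_{\mathbf a}(t)=1$ for all $1\le t\le n-1$.
   Context: A binary sequence of period $n$ is $\mathbf a=(a_0,a_1,\ldots)$ with $a_j\in\{-1,1\}$ and $a_{j+n}=a_j$ for all $j\ge0$; its autocorrelation values are $C_{\mathbf a}(t)=\sum_{i=0}^{n-1}a_ia_{i+t}$, $0\le t\le n-1$. *)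

theory Defs
  imports "HOL-Number_Theory.Number_Theory"
begin

text \<open>The period \<open>n\<close> need not be the least one.\<close>

definition binary_sequence :: "nat \<Rightarrow> (nat \<Rightarrow> int) \<Rightarrow> bool" where
  "binary_sequence n a \<longleftrightarrow> (\<forall>j. a j \<in> {-1, 1}) \<and> (\<forall>j. a (j + n) = a j)"

definition autocorrelation :: "nat \<Rightarrow> (nat \<Rightarrow> int) \<Rightarrow> nat \<Rightarrow> int" where
  "autocorrelation n a t = (\<Sum>i<n. a i * a (i + t))"

definition quadratic_nonresidue :: "int \<Rightarrow> int \<Rightarrow> bool" where
  "quadratic_nonresidue e r \<longleftrightarrow> \<not> e dvd r \<and> \<not> QuadRes e r"

end

theory Submission
  imports Defs "HOL-Computational_Algebra.Polynomial"
begin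

text \<open>
  Replacing \<open>u\<close> by \<open>-u\<close> if necessary, \<open>u - 1 = 2 ^ l * c ^ 2 * r\<close> with \<open>r\<close> an odd nonresidue modulo \<open>e\<close>.
  Hence some odd prime \<open>p\<close> that is a nonresidue modulo \<open>e\<close> divides \<open>n - 1 = (u - 1) * (u + 1) / 2\<close>
  to an odd power, and by Euler's criterion \<open>q = p ^ ((e - 1) / 2)\<close> is \<open>-1\<close> modulo \<open>e\<close>.

  Since \<open>e\<close> divides \<open>n\<close>, folding a sequence with the forbidden autocorrelation modulo \<open>e\<close> gives an
  \<open>e\<close>-periodic integer sequence \<open>b\<close> with autocorrelation \<open>(n - 1) * \<delta> + n / e\<close>.
  Let \<open>f = (\<Sum>i<e. b i * X ^ i)\<close> and \<open>d = (X - 1) * f\<close> in \<open>\<int>[X] / (p, X ^ e - 1)\<close>. There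
  \<open>f ^ q = f (X ^ q) = f (X ^ -1)\<close>, so \<open>p dvd n - 1\<close> forces \<open>d ^ (q + 1) = 0\<close>, whereas
  \<open>d ^ (q ^ 2) = d (X ^ (q ^ 2)) = d\<close>. Thus \<open>d = 0\<close>: all \<open>b i\<close> agree modulo \<open>p\<close>. Subtracting a
  constant and dividing by \<open>p\<close> replaces \<open>n - 1\<close> by \<open>(n - 1) / p ^ 2\<close>, and by descent the exponent
  of \<open>p\<close> in \<open>n - 1\<close> is even, a contradiction.
\<close>

section \<open>Frobenius on integer polynomials modulo a prime\<close>

lemma diff_dvd_power_diff: "x - y dvd x ^ n - (y::'a::comm_ring_1) ^ n"
  by (metis dvd_triv_left power_diff_sumr2)

lemma prime_dvd_freshman:
  fixes x y :: "'a::comm_ring_1"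
  assumes "prime p"
  shows "of_nat p dvd (x + y) ^ p - (x ^ p + y ^ p)"
proof -
  have "p > 0" using assms prime_gt_0_nat by blast
  have "(x + y) ^ p = (\<Sum>k\<le>p. of_nat (p choose k) * x ^ k * y ^ (p - k))"
    by (rule binomial_ring)
  also have "{..p} = insert 0 (insert p {0<..<p})"
    using \<open>p > 0\<close> by auto
  also have "(\<Sum>k\<in>\<dots>. of_nat (p choose k) * x ^ k * y ^ (p - k)) =
      y ^ p + (x ^ p + (\<Sum>k\<in>{0<..<p}. of_nat (p choose k) * x ^ k * y ^ (p - k)))"
    using \<open>p > 0\<close> by simp
  finally have "(x + y) ^ p - (x ^ p + y ^ p) =
      (\<Sum>k\<in>{0<..<p}. of_nat (p choose k) * x ^ k * y ^ (p - k))"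
    by (simp add: algebra_simps)
  also have "of_nat p dvd \<dots>"
  proof (rule dvd_sum)
    fix k assume "k \<in> {0<..<p}"
    then have "p dvd p choose k"
      using assms by (intro dvd_choose_prime) auto
    then have "(of_nat p :: 'a) dvd of_nat (p choose k)"
      by (auto elim!: dvdE)
    then show "of_nat p dvd of_nat (p choose k) * x ^ k * y ^ (p - k)"
      by (simp add: dvd_mult2)
  qed
  finally show ?thesis .
qed

text \<open>This is what lets Frobenius fix constant coefficients. Induction gives the natural
  numbers; a negative \<open>a\<close> is first replaced by its residue.\<close>

lemma fermat_theorem_int:
  fixes a :: int
  assumes "prime p"
  shows "int p dvd a ^ p - a"
proof -
  have nat: "int p dvd int m ^ p - int m" for m
  proof (induction m)
    case 0
    then show ?case using assms prime_gt_0_nat by (simp add: power_0_left)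
  next
    case (Suc m)
    have "int p dvd (int m + 1) ^ p - (int m ^ p + 1 ^ p)"
      using prime_dvd_freshman[OF assms, of "int m" 1] by simp
    from dvd_add[OF this Suc] show ?case by (simp add: algebra_simps)
  qed
  have "[a = int (nat (a mod int p))] (mod int p)"
    using assms prime_gt_0_nat by (simp add: cong_def)
  then have "[a ^ p - a = int (nat (a mod int p)) ^ p - int (nat (a mod int p))] (mod int p)"
    by (intro cong_diff cong_pow)
  with nat show ?thesis
    using cong_dvd_iff dvd_refl cong_0_iff cong_trans by blast
qed


lemma monom_pcompose_monom:
  "pcompose (monom 1 a) (monom (1::'a::comm_ring_1) b) = monom 1 (a * b)"
  by (induction a) (simp_all add: monom_Suc pcompose_pCons mult_monom pcompose_1)

text \<open>Writing a polynomial as \<open>a + X * f\<close> splits its \<open>p\<close>-th power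
  modulo \<open>p\<close>; Fermat turns \<open>a ^ p\<close> into \<open>a\<close>, and induction
  treats \<open>f\<close>. Congruence is phrased as divisibility so that all work stays in the
  integer polynomials.\<close>

lemma prime_dvd_frobenius:
  fixes f :: "int poly"
  assumes "prime p"
  shows "of_nat p dvd f ^ p - pcompose f (monom 1 p)"
proof (induction f)
  case 0
  then show ?case using assms prime_gt_0_nat by (simp add: power_0_left)
next
  case (pCons a f)
  have X: "monom (1::int) p = [:0, 1:] ^ p"
    by (simp add: monom_altdef)
  have split: "pCons a f = [:a:] + [:0, 1:] * f"
    by simp
  have "int p dvd a ^ p - a"
    by (rule fermat_theorem_int[OF assms])
  then have "(of_nat p :: int poly) dvd [:a:] ^ p - [:a:]"
    by (auto elim!: dvdE simp: of_nat_poly poly_const_pow)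
  moreover have "of_nat p dvd (pCons a f) ^ p - ([:a:] ^ p + ([:0, 1:] * f) ^ p)"
    unfolding split by (rule prime_dvd_freshman[OF assms])
  moreover have "of_nat p dvd [:0, 1:] ^ p * (f ^ p - pcompose f (monom 1 p))"
    using pCons.IH by (rule dvd_mult)
  ultimately have "of_nat p dvd ((pCons a f) ^ p - ([:a:] ^ p + ([:0, 1:] * f) ^ p))
      + ([:a:] ^ p - [:a:]) + [:0, 1:] ^ p * (f ^ p - pcompose f (monom 1 p))"
    by (intro dvd_add)
  also have "\<dots> = (pCons a f) ^ p - pcompose (pCons a f) (monom 1 p)"
    by (simp only: pcompose_pCons X power_mult_distrib) (simp add: algebra_simps)
  finally show ?case .
qed

lemma prime_power_dvd_frobenius:
  fixes f :: "int poly"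
  assumes "prime p"
  shows "of_nat p dvd f ^ (p ^ k) - pcompose f (monom 1 (p ^ k))"
proof (induction k)
  case 0
  then show ?case by (simp add: monom_altdef)
next
  case (Suc k)
  let ?g = "pcompose f (monom 1 (p ^ k))"
  have "of_nat p dvd (f ^ (p ^ k)) ^ p - ?g ^ p"
    using Suc diff_dvd_power_diff dvd_trans by blast
  moreover have "of_nat p dvd ?g ^ p - pcompose ?g (monom 1 p)"
    by (rule prime_dvd_frobenius[OF assms])
  ultimately have "of_nat p dvd ((f ^ (p ^ k)) ^ p - ?g ^ p) + (?g ^ p - pcompose ?g (monom 1 p))"
    by (rule dvd_add)
  then show ?case
    by (simp add: monom_pcompose_monom mult.commute flip: power_mult pcompose_assoc)
qed

section \<open>Substitution and reduction modulo \<open>X ^ e - 1\<close>\<close>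

text \<open>Horner induction: for \<open>a + X * f\<close> the difference is
  \<open>(g - h) * f(g) + h * (f(g) - f(h))\<close>. It allows the substituted power of
  \<open>X\<close> to be changed modulo \<open>X ^ e - 1\<close>.\<close>

lemma diff_dvd_pcompose_diff:
  "g - h dvd pcompose f g - pcompose f (h :: 'a::comm_ring_1 poly)"
proof (induction f)
  case (pCons a f)
  have "g - h dvd (g - h) * pcompose f g + h * (pcompose f g - pcompose f h)"
    using pCons.IH by (intro dvd_add) auto
  then show ?case
    by (simp add: pcompose_pCons algebra_simps)
qed simp

lemma monom_diff_dvd_monom_diff:
  assumes "[a = b] (mod e)"
  shows "monom (1::int) e - 1 dvd monom 1 a - monom 1 b"
proof -
  have *: "monom (1::int) e - 1 dvd monom 1 m - monom 1 (m mod e)" for m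
  proof -
    have "monom (1::int) e - 1 dvd monom 1 e ^ (m div e) - 1 ^ (m div e)"
      by (rule diff_dvd_power_diff)
    then have "monom (1::int) e - 1 dvd monom 1 (m mod e) * (monom 1 e ^ (m div e) - 1)"
      by simp
    then show ?thesis
      by (simp add: monom_power mult_monom right_diff_distrib)
  qed
  from dvd_diff[OF *[of a] *[of b]] assms show ?thesis
    by (simp add: cong_def)
qed

section \<open>The ideal generated by \<open>p\<close> and \<open>X ^ e - 1\<close>\<close>

text \<open>With generators \<open>p\<close> and \<open>X ^ e - 1\<close>, membership means
  vanishing in the group algebra of the cyclic group of order \<open>e\<close> over the field with
  \<open>p\<close> elements. No quotient type is formed.\<close>

definition two_ideal :: "'a::comm_ring_1 \<Rightarrow> 'a \<Rightarrow> 'a set" where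
  "two_ideal a b = {a * h + b * k | h k. True}"

lemma two_ideal_add: "x \<in> two_ideal a b \<Longrightarrow> y \<in> two_ideal a b \<Longrightarrow> x + y \<in> two_ideal a b"
  unfolding two_ideal_def
  by clarsimp (metis (no_types, lifting) add.assoc add.left_commute distrib_left)

lemma two_ideal_mult: "x \<in> two_ideal a b \<Longrightarrow> y * x \<in> two_ideal a b"
  unfolding two_ideal_def
  by clarsimp (metis (no_types, lifting) distrib_left mult.left_commute)

lemma two_ideal_dvd1: "a dvd x \<Longrightarrow> x \<in> two_ideal a b"
  unfolding two_ideal_def by clarsimp (metis add.right_neutral dvdE mult_zero_right)

lemma two_ideal_dvd2: "b dvd x \<Longrightarrow> x \<in> two_ideal a b"
  unfolding two_ideal_def by clarsimp (metis add.left_neutral dvdE mult_zero_right)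

lemma two_ideal_diff_cancel:
  assumes "x - y \<in> two_ideal a b" "x \<in> two_ideal a b"
  shows "y \<in> two_ideal a b"
  using two_ideal_add[OF assms(2) two_ideal_mult[OF assms(1), of "-1"]] by simp

text \<open>For \<open>e\<close>-periodic \<open>w\<close> this functional factors through the quotient by \<open>X ^ e - 1\<close>.\<close>

definition weighted_coeffs :: "(nat \<Rightarrow> int) \<Rightarrow> int poly \<Rightarrow> int" where
  "weighted_coeffs w f = (\<Sum>i\<le>degree f. coeff f i * w i)"

lemma weighted_coeffs_bound:
  assumes "degree f \<le> m"
  shows "weighted_coeffs w f = (\<Sum>i\<le>m. coeff f i * w i)"
  unfolding weighted_coeffs_def
  using assms by (intro sum.mono_neutral_left) (auto simp: coeff_eq_0)

lemma weighted_coeffs_add: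
  "weighted_coeffs w (f + g) = weighted_coeffs w f + weighted_coeffs w g"
  using weighted_coeffs_bound[of "f + g" "max (degree f) (degree g)" w]
    weighted_coeffs_bound[of f "max (degree f) (degree g)" w]
    weighted_coeffs_bound[of g "max (degree f) (degree g)" w]
  by (simp add: degree_add_le sum.distrib distrib_right)

lemma weighted_coeffs_smult: "weighted_coeffs w (smult c f) = c * weighted_coeffs w f"
  using weighted_coeffs_bound[of "smult c f" "degree f" w]
  by (simp add: weighted_coeffs_def sum_distrib_left mult.assoc degree_smult_le)

lemma weighted_coeffs_diff:
  "weighted_coeffs w (f - g) = weighted_coeffs w f - weighted_coeffs w g"
  using weighted_coeffs_add[of w "f - g" g] by simp

lemma weighted_coeffs_sum:
  "weighted_coeffs w (sum f A) = (\<Sum>x\<in>A. weighted_coeffs w (f x))"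
  by (induction A rule: infinite_finite_induct)
    (simp_all add: weighted_coeffs_add, simp_all add: weighted_coeffs_def)

lemma weighted_coeffs_monom: "weighted_coeffs w (monom c i) = c * w i"
  using weighted_coeffs_bound[of "monom c i" i w] by (simp add: degree_monom_le if_distrib[of "\<lambda>x. x * _"] cong: if_cong)

text \<open>Multiplication by \<open>X ^ m\<close> moves the coefficient at \<open>i\<close> to
  \<open>i + m\<close>, so it is dual to shifting the weights.\<close>

lemma weighted_coeffs_monom_mult:
  "weighted_coeffs w (monom 1 m * f) = weighted_coeffs (\<lambda>i. w (i + m)) f"
proof -
  have "monom 1 m * f = (\<Sum>i\<le>degree f. monom (coeff f i) (i + m))"
    using poly_as_sum_of_monoms[of f]
    by (metis (no_types, lifting) add.commute mult_1 mult_monom sum.cong sum_distrib_left)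
  then show ?thesis
    by (simp add: weighted_coeffs_sum weighted_coeffs_monom) (simp add: weighted_coeffs_def)
qed

text \<open>Periodic weights annihilate multiples of \<open>X ^ e - 1\<close>, and multiples of
  \<open>p\<close> take values divisible by \<open>p\<close>. Coefficients of a member can thus be
  read off modulo \<open>p\<close>.\<close>

lemma dvd_weighted_coeffs:
  assumes "\<And>i. w (i + e) = w i" and "f \<in> two_ideal (of_nat p) (monom 1 e - 1)"
  shows "int p dvd weighted_coeffs w f"
proof -
  obtain h k where f: "f = of_nat p * h + (monom 1 e - 1) * k"
    using assms(2) by (auto simp: two_ideal_def)
  have "weighted_coeffs w ((monom 1 e - 1) * k) = 0"
    using assms(1) by (simp add: left_diff_distrib weighted_coeffs_diff weighted_coeffs_monom_mult)
  moreover have "weighted_coeffs w (of_nat p * h) = int p * weighted_coeffs w h"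
    by (simp add: of_nat_poly weighted_coeffs_smult)
  ultimately show ?thesis
    by (simp add: f weighted_coeffs_add)
qed

section \<open>Autocorrelation as a product of polynomials\<close>

text \<open>Moving the window by one replaces the monomial at \<open>j\<close> by the one at
  \<open>e + j\<close>, and these differ by \<open>b j * X ^ j * (X ^ e - 1)\<close>.\<close>

lemma dvd_periodic_sum_shift:
  fixes b :: "nat \<Rightarrow> int"
  assumes "\<And>i. b (i + e) = b i"
  shows "monom 1 e - 1 dvd (\<Sum>i<e. monom (b i) i) - (\<Sum>i<e. monom (b (i + j)) (i + j))"
proof (induction j)
  case (Suc j)
  have "(\<Sum>i<e. monom (b (i + Suc j)) (i + Suc j)) - (\<Sum>i<e. monom (b (i + j)) (i + j))
      = (\<Sum>i<e. monom (b (Suc i + j)) (Suc i + j) - monom (b (i + j)) (i + j))"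
    by (simp add: sum_subtractf)
  also have "\<dots> = monom (b (e + j)) (e + j) - monom (b (0 + j)) (0 + j)"
    by (rule sum_lessThan_telescope)
  also have "\<dots> = (monom 1 e - 1) * monom (b j) j"
    using assms[of j] by (simp add: left_diff_distrib mult_monom add.commute)
  finally have "monom 1 e - 1 dvd (\<Sum>i<e. monom (b (i + Suc j)) (i + Suc j)) - (\<Sum>i<e. monom (b (i + j)) (i + j))"
    by simp
  from dvd_diff[OF Suc this] show ?case
    by simp
qed simp

lemma pcompose_monom_monom:
  "pcompose (monom c a) (monom (1::'a::comm_ring_1) b) = monom c (a * b)"
  using pcompose_smult[of c "monom 1 a" "monom 1 b"]
  by (simp add: monom_pcompose_monom smult_monom)

text \<open>Since \<open>q\<close> is \<open>-1\<close> modulo \<open>e\<close>, substituting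
  \<open>X ^ q\<close> amounts to substituting the inverse of \<open>X\<close>; the product then
  collects \<open>b j * b (j + t)\<close> at \<open>X ^ t\<close>.\<close>

lemma monom_diff_dvd_autocorrelation:
  fixes b :: "nat \<Rightarrow> int"
  assumes per: "\<And>i. b (i + e) = b i" and "e dvd q + 1"
  defines "f \<equiv> \<Sum>i<e. monom (b i) i"
  shows "monom 1 e - 1 dvd f * pcompose f (monom 1 q) - (\<Sum>t<e. monom (\<Sum>i<e. b i * b (i + t)) t)"
proof -
  let ?D = "monom (1::int) e - 1"
  have each: "?D dvd f * monom (b j) (j * q) - (\<Sum>t<e. monom (b j * b (j + t)) t)" for j
  proof -
    \<comment> \<open>Rewriting \<open>f\<close> over the window starting at \<open>j\<close> makes
      the exponents \<open>t + j + j * q\<close>, which reduce to \<open>t\<close>.\<close>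
    have "?D dvd (f - (\<Sum>i<e. monom (b (i + j)) (i + j))) * monom (b j) (j * q)"
      unfolding f_def by (rule dvd_mult2[OF dvd_periodic_sum_shift[of b e, OF per]])
    moreover have "?D dvd (\<Sum>t<e. monom (b (t + j)) (t + j)) * monom (b j) (j * q)
        - (\<Sum>t<e. monom (b j * b (j + t)) t)"
    proof -
      have "?D dvd monom (b j * b (j + t)) (t + j + j * q) - monom (b j * b (j + t)) t" for t
      proof -
        have "[j * (q + 1) + t = 0 + t] (mod e)"
          using assms(2) by (intro cong_add) (simp_all only: cong_0_iff dvd_mult cong_refl)
        then have "[t + j + j * q = t] (mod e)"
          by (simp add: algebra_simps)
        then have "?D dvd monom 1 (t + j + j * q) - monom 1 t"
          by (rule monom_diff_dvd_monom_diff)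
        then have "?D dvd smult (b j * b (j + t)) (monom 1 (t + j + j * q) - monom 1 t)"
          by (rule dvd_smult)
        then show ?thesis
          by (simp add: smult_diff_right smult_monom)
      qed
      then show ?thesis
        by (simp add: sum_distrib_right mult_monom add.commute[of j] mult.commute[of "b j"] dvd_sum flip: sum_subtractf)
    qed
    ultimately have "?D dvd (f - (\<Sum>i<e. monom (b (i + j)) (i + j))) * monom (b j) (j * q)
       + ((\<Sum>t<e. monom (b (t + j)) (t + j)) * monom (b j) (j * q)
        - (\<Sum>t<e. monom (b j * b (j + t)) t))"
      by (rule dvd_add)
    then show ?thesis
      by (simp add: algebra_simps)
  qed
  have "pcompose f (monom 1 q) = (\<Sum>j<e. monom (b j) (j * q))"
    by (simp add: f_def pcompose_sum pcompose_monom_monom)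
  moreover have "(\<Sum>t<e. monom (\<Sum>i<e. b i * b (i + t)) t) = (\<Sum>j<e. \<Sum>t<e. monom (b j * b (j + t)) t)"
    by (subst sum.swap) (simp add: monom_sum)
  ultimately have "f * pcompose f (monom 1 q) - (\<Sum>t<e. monom (\<Sum>i<e. b i * b (i + t)) t)
    = (\<Sum>j<e. f * monom (b j) (j * q) - (\<Sum>t<e. monom (b j * b (j + t)) t))"
    by (simp add: sum_distrib_left sum_subtractf)
  with each show ?thesis
    by (simp add: dvd_sum)
qed

lemma smult_sum_right: "smult c (sum f A) = (\<Sum>x\<in>A. smult c (f x))"
  by (induction A rule: infinite_finite_induct) (simp_all add: smult_add_right)

section \<open>Constancy modulo \<open>p\<close> and descent\<close>

text \<open>The factor \<open>X - 1\<close> removes the constant level \<open>M\<close>, and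
  \<open>N\<close> vanishes modulo \<open>p\<close>, so \<open>d\<close> is nilpotent in the
  quotient. Some iterate of Frobenius is the identity there, which forces \<open>d\<close> to
  vanish.\<close>

lemma constant_mod_prime_if_two_level_autocorrelation:
  fixes b :: "nat \<Rightarrow> int" and N M :: int
  assumes p: "prime p" and e: "e dvd p ^ k + 1" "k > 0"
    and per: "\<And>i. b (i + e) = b i"
    and corr: "\<And>t. t < e \<Longrightarrow> (\<Sum>i<e. b i * b (i + t)) = (if t = 0 then N else 0) + M"
    and N: "int p dvd N"
    and i: "i < e"
  shows "[b i = b 0] (mod int p)"
proof -
  let ?q = "p ^ k" and ?D = "monom (1::int) e - 1" and ?X = "monom (1::int) 1"
  let ?I = "two_ideal (of_nat p) ?D"
  define f where "f = (\<Sum>i<e. monom (b i) i)"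
  define d where "d = (?X - 1) * f"
  have "e > 0" using i by simp
  have "p \<ge> 2" using p prime_ge_2_nat by blast
  \<comment> \<open>The correlation polynomial is
    \<open>N + M * (1 + X + ... + X ^ (e - 1))\<close>, and \<open>X - 1\<close> turns its second
    part into \<open>M * (X ^ e - 1)\<close>.\<close>
  have I1: "(?X - 1) * (\<Sum>t<e. monom (\<Sum>i<e. b i * b (i + t)) t) \<in> ?I"
  proof -
    have "(\<Sum>t<e. monom (\<Sum>i<e. b i * b (i + t)) t) = (\<Sum>t<e. (if t = 0 then [:N:] else 0) + smult M (monom 1 t))"
      using corr by (intro sum.cong) (auto simp: smult_monom monom_0 simp flip: add_monom)
    also have "\<dots> = [:N:] + smult M (\<Sum>t<e. ?X ^ t)"
      using \<open>e > 0\<close> by (simp add: sum.distrib monom_power smult_sum_right)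
    finally have "(?X - 1) * (\<Sum>t<e. monom (\<Sum>i<e. b i * b (i + t)) t)
        = (?X - 1) * [:N:] + smult M ((?X - 1) * (\<Sum>t<e. ?X ^ t))"
      by (simp add: distrib_left)
    also have "(?X - 1) * (\<Sum>t<e. ?X ^ t) = ?D"
      using power_diff_1_eq[of ?X e] by (simp add: monom_power)
    finally have "(?X - 1) * (\<Sum>t<e. monom (\<Sum>i<e. b i * b (i + t)) t) = (?X - 1) * [:N:] + smult M ?D" .
    moreover have "of_nat p dvd (?X - 1) * [:N:]"
      using N by (intro dvd_mult) (auto elim!: dvdE simp: of_nat_poly)
    ultimately show ?thesis
      using two_ideal_add[OF two_ideal_dvd1 two_ideal_dvd2[of ?D "smult M ?D"]] by (simp add: dvd_smult)
  qed
  have I2: "(?X - 1) * (f * pcompose f (monom 1 ?q)) \<in> ?I"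
  proof -
    have "?D dvd (?X - 1) * (f * pcompose f (monom 1 ?q) - (\<Sum>t<e. monom (\<Sum>i<e. b i * b (i + t)) t))"
      unfolding f_def by (intro dvd_mult monom_diff_dvd_autocorrelation per e(1))
    from two_ideal_add[OF two_ideal_dvd2[OF this] I1] show ?thesis
      by (simp add: right_diff_distrib)
  qed
  have I3: "(?X - 1) * (f * f ^ ?q) \<in> ?I"
  proof -
    have "of_nat p dvd ((?X - 1) * f) * (f ^ ?q - pcompose f (monom 1 ?q))"
      by (intro dvd_mult prime_power_dvd_frobenius p)
    from two_ideal_add[OF two_ideal_dvd1[OF this] I2] show ?thesis
      by (simp add: algebra_simps)
  qed
  \<comment> \<open>As \<open>k > 0\<close>, \<open>?q + 1 \<le> ?q ^ 2\<close>, so this power is a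
    multiple of \<open>d ^ (?q + 1)\<close>, which contains the product in
    \<open>I3\<close>.\<close>
  have I4: "d ^ (p ^ (2 * k)) \<in> ?I"
  proof -
    have "?q \<ge> 2"
      using \<open>p \<ge> 2\<close> \<open>k > 0\<close> self_le_power[of p k] by simp
    then have "?q * 2 \<le> ?q * ?q" by simp
    with \<open>?q \<ge> 2\<close> have "?q + 1 \<le> ?q * ?q" by linarith
    then have "?q + 1 \<le> p ^ (2 * k)" by (simp add: mult_2 power_add)
    then obtain m where "p ^ (2 * k) = ?q + 1 + m"
      using le_Suc_ex by blast
    moreover have "d ^ (?q + 1) = (?X - 1) ^ ?q * ((?X - 1) * (f * f ^ ?q))"
      by (simp only: d_def power_add power_one_right power_mult_distrib mult_ac)
    ultimately have "d ^ (p ^ (2 * k)) = (d ^ m * (?X - 1) ^ ?q) * ((?X - 1) * (f * f ^ ?q))"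
      by (simp only: power_add[of d "?q + 1" m] mult_ac)
    then show ?thesis
      using I3 by (simp only: two_ideal_mult)
  qed
  have "of_nat p dvd d ^ (p ^ (2 * k)) - pcompose d (monom 1 (p ^ (2 * k)))"
    by (rule prime_power_dvd_frobenius[OF p])
  from two_ideal_diff_cancel[OF two_ideal_dvd1[OF this] I4]
  have I5: "pcompose d (monom 1 (p ^ (2 * k))) \<in> ?I" .
  \<comment> \<open>Factor \<open>p ^ (2 * k) - 1\<close> as
    \<open>(p ^ k + 1) * (p ^ k - 1)\<close>. Substituting \<open>X ^ (p ^ (2 * k))\<close>
    therefore acts as the identity modulo \<open>X ^ e - 1\<close>.\<close>
  have "[p ^ (2 * k) = 1] (mod e)"
  proof -
    have "int e dvd (int p ^ k + 1) * (int p ^ k - 1)"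
      using e(1) by (metis dvd_mult2 int_dvd_int_iff of_nat_1 of_nat_add of_nat_power)
    also have "(int p ^ k + 1) * (int p ^ k - 1) = int (p ^ (2 * k)) - int 1"
      by (simp add: power_even_eq power2_eq_square distrib_right right_diff_distrib)
    finally have "[int (p ^ (2 * k)) = int 1] (mod int e)"
      by (simp only: cong_iff_dvd_diff)
    then show ?thesis
      by (simp only: cong_int_iff)
  qed
  then have "?D dvd monom 1 (p ^ (2 * k)) - ?X"
    by (rule monom_diff_dvd_monom_diff)
  then have "?D dvd pcompose d (monom 1 (p ^ (2 * k))) - pcompose d ?X"
    using diff_dvd_pcompose_diff dvd_trans by blast
  from two_ideal_diff_cancel[OF two_ideal_dvd2[OF this] I5]
  have "d \<in> ?I"
    by (simp add: monom_altdef)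
  have consecutive: "[b (Suc s) = b s] (mod int p)" if "Suc s < e" for s
  proof -
    \<comment> \<open>The indicator of the residue class of \<open>Suc s\<close> extracts from
      \<open>d = X * f - f\<close> the coefficient \<open>b s - b (Suc s)\<close>.\<close>
    define w where "w i = (if i mod e = Suc s then 1 else 0 :: int)" for i
    have "int p dvd weighted_coeffs w d"
      using \<open>d \<in> ?I\<close> by (intro dvd_weighted_coeffs) (auto simp: w_def)
    also have "weighted_coeffs w d = (\<Sum>i<e. b i * w (i + 1)) - (\<Sum>i<e. b i * w i)"
      by (simp add: d_def left_diff_distrib weighted_coeffs_diff weighted_coeffs_monom_mult)
        (simp add: f_def weighted_coeffs_sum weighted_coeffs_monom)
    also have "(\<Sum>i<e. b i * w (i + 1)) = (\<Sum>i<e. if i = s then b s else 0)"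
      using that by (intro sum.cong) (auto simp: w_def mod_Suc)
    also have "(\<Sum>i<e. b i * w i) = (\<Sum>i<e. if i = Suc s then b (Suc s) else 0)"
      using that by (intro sum.cong) (auto simp: w_def)
    finally show ?thesis
      using that by (simp add: cong_iff_dvd_diff dvd_diff_commute)
  qed
  from i show ?thesis
    by (induction i) (auto intro: cong_trans[OF consecutive])
qed

text \<open>If \<open>p\<close> divides \<open>N\<close>, then \<open>b\<close> is constant modulo
  \<open>p\<close>; removing the constant and dividing by \<open>p\<close> gives a sequence of the
  same kind with \<open>N\<close> divided by \<open>p ^ 2\<close>. The descent ends when
  \<open>p\<close> does not divide \<open>N\<close>.\<close>

lemma even_multiplicity_if_two_level_autocorrelation:
  fixes b :: "nat \<Rightarrow> int" and N M :: int
  assumes p: "prime p" and e: "e dvd p ^ k + 1" "k > 0" "e > 1"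
    and "\<And>i. b (i + e) = b i"
    and "\<And>t. t < e \<Longrightarrow> (\<Sum>i<e. b i * b (i + t)) = (if t = 0 then N else 0) + M"
    and "N \<noteq> 0"
  shows "even (multiplicity (int p) N)"
  using assms(5-)
proof (induction "nat \<bar>N\<bar>" arbitrary: N M b rule: less_induct)
  case less
  note per = less.prems(1) and corr = less.prems(2)
  have "p \<ge> 2" using p prime_ge_2_nat by blast
  show ?case
  proof (cases "int p dvd N")
    case False
    then show ?thesis by (simp add: not_dvd_imp_multiplicity_0)
  next
    case True
    have bmod: "b i = b (i mod e)" for i
    proof -
      have "b (m + j * e) = b m" for m j
        by (induction j) (simp_all add: per add.assoc[symmetric] add.commute[of e])
      from this[of "i mod e" "i div e"] show ?thesis by simp
    qed
    have "[b (i mod e) = b 0] (mod int p)" for i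
      using constant_mod_prime_if_two_level_autocorrelation[OF p e(1,2) per corr True, of "i mod e"] e(3)
      by simp
    then have "int p dvd b i - b 0" for i
      using bmod[of i] by (simp add: cong_iff_dvd_diff)
    then have "\<forall>i. \<exists>c. b i = b 0 + int p * c"
      by (metis add.commute diff_add_cancel dvdE)
    then obtain c where c: "\<And>i. b i = b 0 + int p * c i"
      by metis
    have cper: "c (i + e) = c i" for i
      using per[of i] c[of i] c[of "i + e"] \<open>p \<ge> 2\<close> by auto
    \<comment> \<open>Expanding \<open>(b i - b 0) * (b (i + t) - b 0)\<close> adds a correction
      independent of \<open>t\<close>, because sums over a full period are shift invariant.\<close>
    define M' where "M' = M - b 0 * (2 * (\<Sum>i<e. b i) - int e * b 0)"
    have ccorr: "int p ^ 2 * (\<Sum>i<e. c i * c (i + t)) = (if t = 0 then N else 0) + M'" if "t < e" for t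
    proof -
      have shift: "(\<Sum>i<e. b (i + t)) = (\<Sum>i<e. b i)"
      proof (induction t)
        case (Suc t)
        have "(\<Sum>i<e. b (i + Suc t)) - (\<Sum>i<e. b (i + t)) = (\<Sum>i<e. b (Suc i + t) - b (i + t))"
          by (simp add: sum_subtractf)
        also have "\<dots> = b (e + t) - b (0 + t)"
          by (rule sum_lessThan_telescope)
        finally show ?case using Suc per[of t] by (simp add: add.commute)
      qed simp
      have "int p ^ 2 * (\<Sum>i<e. c i * c (i + t)) = (\<Sum>i<e. (b i - b 0) * (b (i + t) - b 0))"
        unfolding sum_distrib_left
        by (rule sum.cong) (simp_all add: c[of "_ + t"] c[of "Suc _"] power2_eq_square, (subst c, simp)+)
      also have "\<dots> = (\<Sum>i<e. b i * b (i + t)) - b 0 * (\<Sum>i<e. b (i + t)) - b 0 * (\<Sum>i<e. b i) + int e * (b 0 * b 0)"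
        by (simp add: algebra_simps sum.distrib sum_subtractf sum_distrib_left)
      also have "\<dots> = (if t = 0 then N else 0) + M'"
        using corr[OF that] shift by (simp add: M'_def algebra_simps)
      finally show ?thesis .
    qed
    \<comment> \<open>The nonzero shift \<open>1\<close> exists because \<open>e > 1\<close>. It
      isolates \<open>M'\<close>; comparison with shift \<open>0\<close> then upgrades
      \<open>p dvd N\<close> to \<open>p ^ 2 dvd N\<close>.\<close>
    have "M' = int p ^ 2 * (\<Sum>i<e. c i * c (i + 1))"
      using ccorr[of 1] e(3) by simp
    then have "int p ^ 2 dvd M'" by simp
    then obtain M1 where M1: "M' = int p ^ 2 * M1" ..
    have "N + M' = int p ^ 2 * (\<Sum>i<e. c i * c (i + 0))"
      using ccorr[of 0] e(3) by simp
    then have "int p ^ 2 dvd N + M'" by simp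
    with \<open>int p ^ 2 dvd M'\<close> have "int p ^ 2 dvd N"
      by (simp add: dvd_add_left_iff)
    then obtain N1 where N1: "N = int p ^ 2 * N1" ..
    have "N1 \<noteq> 0" using N1 less.prems(3) by auto
    have "even (multiplicity (int p) N1)"
    proof (rule less.hyps[of N1 c M1])
      have "1 * \<bar>N1\<bar> < int p ^ 2 * \<bar>N1\<bar>"
        using \<open>N1 \<noteq> 0\<close> \<open>p \<ge> 2\<close> by (intro mult_strict_right_mono one_less_power) auto
      then show "nat \<bar>N1\<bar> < nat \<bar>N\<bar>"
        using less.prems(3) by (simp add: N1 abs_mult)
      show "(\<Sum>i<e. c i * c (i + t)) = (if t = 0 then N1 else 0) + M1" if "t < e" for t
      proof -
        have "int p ^ 2 * (\<Sum>i<e. c i * c (i + t)) = int p ^ 2 * ((if t = 0 then N1 else 0) + M1)"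
          using ccorr[OF that] by (auto simp: N1 M1 algebra_simps)
        then show ?thesis using \<open>p \<ge> 2\<close> by simp
      qed
    qed (use cper \<open>N1 \<noteq> 0\<close> in auto)
    moreover have "prime_elem (int p)"
      using p by simp
    then have "multiplicity (int p) N = 2 + multiplicity (int p) N1"
      using \<open>N1 \<noteq> 0\<close> \<open>p \<ge> 2\<close>
      by (simp add: N1 prime_elem_multiplicity_mult_distrib multiplicity_same_power)
    ultimately show ?thesis by simp
  qed
qed

section \<open>Quadratic residues and prime factorizations\<close>

lemma QuadRes_mult:
  assumes "QuadRes e a" "QuadRes e b"
  shows "QuadRes e (a * b)"
proof -
  obtain y z where "[y ^ 2 = a] (mod e)" "[z ^ 2 = b] (mod e)"
    using assms by (auto simp: QuadRes_def)
  then have "[(y * z) ^ 2 = a * b] (mod e)"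
    by (simp add: power_mult_distrib cong_mult)
  then show ?thesis by (auto simp: QuadRes_def)
qed

lemma QuadRes_prod:
  assumes "\<And>x. x \<in> A \<Longrightarrow> QuadRes e (f x)"
  shows "QuadRes e (prod f A)"
proof -
  have "QuadRes e 1"
    unfolding QuadRes_def by (rule exI[of _ 1]) simp
  with assms show ?thesis
    by (induction A rule: infinite_finite_induct) (auto intro: QuadRes_mult)
qed

text \<open>Prime powers with even exponent are squares, those with odd exponent are powers of
  residues, and the sign is a residue by assumption. The contrapositive yields a nonresidue prime of
  odd exponent.\<close>

lemma QuadRes_if_nonresidue_multiplicities_even:
  fixes r :: int
  assumes "r \<noteq> 0" "QuadRes e (-1)"
    and "\<And>p. prime p \<Longrightarrow> p dvd r \<Longrightarrow> odd (multiplicity p r) \<Longrightarrow> QuadRes e p"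
  shows "QuadRes e r"
proof -
  have pow: "QuadRes e (p ^ m)" if "QuadRes e p" for p m
    using QuadRes_prod[of "{..<m}" e "\<lambda>_. p"] that by simp
  have "QuadRes e (p ^ multiplicity p r)" if "p \<in> prime_factors r" for p
  proof (cases "even (multiplicity p r)")
    case True
    then obtain m where "multiplicity p r = 2 * m" ..
    then have "[(p ^ m) ^ 2 = p ^ multiplicity p r] (mod e)"
      by (simp add: power_mult mult.commute)
    then show ?thesis by (auto simp only: QuadRes_def)
  next
    case False
    with that assms(3) show ?thesis by (intro pow) (auto simp: in_prime_factors_iff)
  qed
  then have "QuadRes e (\<Prod>p\<in>prime_factors r. p ^ multiplicity p r)"
    by (rule QuadRes_prod)
  then have "QuadRes e \<bar>r\<bar>"
    using assms(1) by (simp add: prod_prime_factors)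
  then show ?thesis
    using QuadRes_mult[OF assms(2), of "\<bar>r\<bar>"] by (cases "r \<ge> 0") auto
qed

section \<open>Folding a sequence onto a divisor of its period\<close>

text \<open>Folding is push-forward from the cyclic group of order \<open>e * m\<close> to that of
  order \<open>e\<close>, so the correlation at \<open>t\<close> sums those at all shifts lying over
  \<open>t\<close>.\<close>

lemma autocorrelation_folded:
  fixes a :: "nat \<Rightarrow> int"
  assumes "\<And>j. a (j + e * m) = a j"
  defines "b \<equiv> \<lambda>j. \<Sum>i<m. a (j + i * e)"
  shows "b (j + e) = b j"
    and "(\<Sum>j<e. b j * b (j + t)) = (\<Sum>i<m. autocorrelation (e * m) a (t + i * e))"
proof -
  have b_eq: "b j = (\<Sum>i<m. a (j + i * e))" for j
    by (simp add: b_def)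
  show per: "b (j + e) = b j" for j
  proof -
    have "b (j + e) - b j = (\<Sum>i<m. a (j + Suc i * e) - a (j + i * e))"
      by (simp add: b_def sum_subtractf algebra_simps)
    also have "\<dots> = a (j + m * e) - a (j + 0 * e)"
      by (rule sum_lessThan_telescope)
    also have "\<dots> = 0" using assms(1)[of j] by (simp add: mult.commute)
    finally show ?thesis by simp
  qed
  have per': "b (j + i * e) = b j" for i j
    by (induction i) (simp_all add: per add.assoc[symmetric] add.commute[of e])
  \<comment> \<open>Only the first factor is unfolded; periodicity of \<open>b\<close> lets the
    second follow the index \<open>j + i * e\<close>, which runs once through all
    \<open>x < e * m\<close>.\<close>
  have "(\<Sum>j<e. b j * b (j + t)) = (\<Sum>j<e. \<Sum>i<m. a (j + i * e) * b (j + i * e + t))"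
  proof (rule sum.cong)
    fix j
    have "b (j + i * e + t) = b (j + t)" for i
      using per'[of "j + t" i] by (simp add: ac_simps)
    then show "b j * b (j + t) = (\<Sum>i<m. a (j + i * e) * b (j + i * e + t))"
      by (simp add: b_eq[of j] sum_distrib_right)
  qed simp
  also have "\<dots> = (\<Sum>i<m. \<Sum>j<e. a (j + i * e) * b (j + i * e + t))"
    by (rule sum.swap)
  also have "\<dots> = (\<Sum>x<e * m. a x * b (x + t))"
  proof -
    have "(\<Sum>j<e. a (j + i * e) * b (j + i * e + t)) = (\<Sum>x\<in>{i * e..<i * e + e}. a x * b (x + t))" for i
      using sum.shift_bounds_nat_ivl[of "\<lambda>x. a x * b (x + t)" 0 "i * e" e]
      by (simp add: atLeast0LessThan add.commute)
    then show ?thesis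
      by (simp add: sum.nat_group mult.commute[of e])
  qed
  also have "\<dots> = (\<Sum>x<e * m. \<Sum>i<m. a x * a (x + (t + i * e)))"
    by (simp add: b_def sum_distrib_left add.assoc)
  also have "\<dots> = (\<Sum>i<m. autocorrelation (e * m) a (t + i * e))"
    by (subst sum.swap) (simp add: autocorrelation_def)
  finally show "(\<Sum>j<e. b j * b (j + t)) = (\<Sum>i<m. autocorrelation (e * m) a (t + i * e))" .
qed

section \<open>A nonresidue prime of odd exponent in \<open>n - 1\<close>\<close>

text \<open>A nonresidue prime with odd exponent in \<open>r\<close> is odd and divides
  \<open>u - 1\<close>, hence not \<open>u + 1\<close>. The factor \<open>c ^ 2\<close> changes its
  exponent only by an even number.\<close>

lemma nonresidue_prime_odd_multiplicity:
  fixes u e c r N :: int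
  assumes "QuadRes e (-1)" "\<not> QuadRes e r" "odd r" "c \<noteq> 0"
    and u: "u = 2 ^ l * c ^ 2 * r + 1" and "u \<noteq> -1" and N: "2 * N = u ^ 2 - 1"
  obtains p where "prime p" "\<not> QuadRes e p" "odd (multiplicity p N)"
proof -
  have "r \<noteq> 0" using \<open>odd r\<close> by auto
  with QuadRes_if_nonresidue_multiplicities_even[OF _ assms(1), of r] assms(2)
  obtain p where p: "prime p" "p dvd r" "odd (multiplicity p r)" "\<not> QuadRes e p"
    by blast
  have "prime_elem p" using p(1) by (rule prime_imp_prime_elem)
  have "\<not> p dvd 2"
    using p(1,2) \<open>odd r\<close> zdvd_imp_le[of p 2] prime_ge_2_int[of p] by auto
  have "u - 1 \<noteq> 0"
    using u \<open>c \<noteq> 0\<close> \<open>r \<noteq> 0\<close> by simp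
  have "p dvd u - 1" using p(2) u by simp
  then have "\<not> p dvd u + 1"
    using \<open>\<not> p dvd 2\<close> dvd_diff[of p "u + 1" "u - 1"] by auto
  have "u ^ 2 - 1 = (u - 1) * (u + 1)"
    by (simp add: power2_eq_square algebra_simps)
  with \<open>u - 1 \<noteq> 0\<close> \<open>u \<noteq> -1\<close> N have "N \<noteq> 0" by auto
  then have "multiplicity p N = multiplicity p (2 * N)"
    using \<open>prime_elem p\<close> \<open>\<not> p dvd 2\<close>
    by (simp add: prime_elem_multiplicity_mult_distrib not_dvd_imp_multiplicity_0)
  also have "\<dots> = multiplicity p (u - 1) + multiplicity p (u + 1)"
    unfolding N \<open>u ^ 2 - 1 = (u - 1) * (u + 1)\<close>
    using \<open>prime_elem p\<close> \<open>u - 1 \<noteq> 0\<close> \<open>u \<noteq> -1\<close>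
    by (intro prime_elem_multiplicity_mult_distrib) auto
  also have "multiplicity p (u + 1) = 0"
    using \<open>\<not> p dvd u + 1\<close> by (rule not_dvd_imp_multiplicity_0)
  also have "u - 1 = 2 ^ l * (c ^ 2 * r)"
    using u by simp
  also have "multiplicity p (2 ^ l * (c ^ 2 * r)) = 2 * multiplicity p c + multiplicity p r"
    using \<open>prime_elem p\<close> \<open>\<not> p dvd 2\<close> \<open>c \<noteq> 0\<close> \<open>r \<noteq> 0\<close>
    by (simp add: prime_elem_multiplicity_mult_distrib prime_elem_multiplicity_power_distrib
        not_dvd_imp_multiplicity_0)
  finally have "odd (multiplicity p N)"
    using p(3) by simp
  with p show ?thesis using that by blast
qed

lemma QuadRes_cong: "[a = b] (mod e) \<Longrightarrow> QuadRes e a \<longleftrightarrow> QuadRes e b"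
  unfolding QuadRes_def by (meson cong_sym cong_trans)

section \<open>Nonexistence of the sequence\<close>

theorem theorem2p10:
  fixes e u :: int and n :: nat
  assumes "prime e" and "[e = 1] (mod 4)"
    and "odd u" and "[u^2 = -1] (mod e)"
    and "\<exists>(c::int) (l::nat) (r::int).
           c > 0 \<and> 2 dvd 2^l * c \<and> odd r \<and> quadratic_nonresidue e r \<and>
           ([u = 2^l * c^2 * r + 1] (mod (2^(l+1) * c^2 * e)) \<or>
            [u = 2^l * c^2 * r - 1] (mod (2^(l+1) * c^2 * e)))"
    and "2 * int n = u^2 + 1"
  shows "\<not> (\<exists>a. binary_sequence n a \<and>
               (\<forall>t. 1 \<le> t \<and> t \<le> n - 1 \<longrightarrow> autocorrelation n a t = 1))"
proof
  assume "\<exists>a. binary_sequence n a \<and>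
               (\<forall>t. 1 \<le> t \<and> t \<le> n - 1 \<longrightarrow> autocorrelation n a t = 1)"
  then obtain a where a: "binary_sequence n a"
    and C: "\<And>t. 1 \<le> t \<Longrightarrow> t \<le> n - 1 \<Longrightarrow> autocorrelation n a t = 1"
    by blast
  have "e > 1" using \<open>prime e\<close> prime_gt_1_int by blast
  have "e mod 4 = 1" using assms(2) by (simp add: cong_def)
  with \<open>e > 1\<close> have "e > 2" by presburger
  have QR: "QuadRes e (-1)"
    using assms(4) by (auto simp: QuadRes_def)
  have e_dvd: "e dvd u ^ 2 + 1"
    using assms(4) by (simp add: cong_iff_dvd_diff)
  \<comment> \<open>Otherwise \<open>e\<close> would divide \<open>2\<close>. This ensures that
    \<open>n - 1\<close> is nonzero.\<close>
  have "u ^ 2 \<noteq> 1"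
    using e_dvd \<open>e > 2\<close> zdvd_imp_le[of e 2] by auto

  obtain c l r where c: "c > 0" "odd r" "quadratic_nonresidue e r"
    and u: "[u = 2^l * c^2 * r + 1] (mod (2^(l+1) * c^2 * e)) \<or>
            [u = 2^l * c^2 * r - 1] (mod (2^(l+1) * c^2 * e))"
    using assms(5) by blast
  \<comment> \<open>The period depends only on \<open>u ^ 2\<close>, so the sign of \<open>u\<close>
    is free. The multiple of the modulus is absorbed into \<open>s = r + 2 * e * k\<close> or its
    negative: parity and nonresidue status survive, since \<open>-1\<close> is a square modulo
    \<open>e\<close>.\<close>
  have "\<exists>v s. (v = u \<or> v = - u) \<and> odd s \<and> \<not> QuadRes e s \<and> v = 2 ^ l * c ^ 2 * s + 1"
    using u
  proof
    assume "[u = 2^l * c^2 * r + 1] (mod (2^(l+1) * c^2 * e))"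
    then obtain k where "u = 2^l * c^2 * r + 1 + 2^(l+1) * c^2 * e * k"
      by (metis cong_iff_lin cong_sym)
    then have "u = 2 ^ l * c ^ 2 * (r + 2 * e * k) + 1"
      by (simp add: algebra_simps)
    moreover have "[r + 2 * e * k = r] (mod e)"
      by (simp add: cong_iff_dvd_diff)
    then have "\<not> QuadRes e (r + 2 * e * k)"
      using c(3) QuadRes_cong unfolding quadratic_nonresidue_def by blast
    ultimately show ?thesis using c(2) by (intro exI[of _ u] exI[of _ "r + 2 * e * k"]) auto
  next
    assume "[u = 2^l * c^2 * r - 1] (mod (2^(l+1) * c^2 * e))"
    then obtain k where "u = 2^l * c^2 * r - 1 + 2^(l+1) * c^2 * e * k"
      by (metis cong_iff_lin cong_sym)
    then have "- u = 2 ^ l * c ^ 2 * (- (r + 2 * e * k)) + 1"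
      by (simp add: algebra_simps)
    moreover have "[r + 2 * e * k = r] (mod e)"
      by (simp add: cong_iff_dvd_diff)
    then have "\<not> QuadRes e (r + 2 * e * k)"
      using c(3) QuadRes_cong unfolding quadratic_nonresidue_def by blast
    then have "\<not> QuadRes e (- (r + 2 * e * k))"
      using QuadRes_mult[OF QR, of "- (r + 2 * e * k)"] by (metis mult_minus1 minus_minus)
    ultimately show ?thesis using c(2) by (intro exI[of _ "-u"] exI[of _ "- (r + 2 * e * k)"]) auto
  qed
  then obtain v s where v: "v = u \<or> v = - u" "odd s" "\<not> QuadRes e s" "v = 2 ^ l * c ^ 2 * s + 1"
    by blast
  have "2 * (int n - 1) = v ^ 2 - 1" and "v \<noteq> -1"
    using v(1) assms(6) \<open>u ^ 2 \<noteq> 1\<close> by auto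
  then obtain p' where p': "prime p'" "\<not> QuadRes e p'" "odd (multiplicity p' (int n - 1))"
    using nonresidue_prime_odd_multiplicity[OF QR v(3,2) _ v(4), of "int n - 1"] c(1) by auto
  define p where "p = nat p'"
  have p_int: "int p = p'"
    using prime_ge_0_int[OF p'(1)] by (simp add: p_def)
  have p: "prime p"
    using p'(1) by (simp flip: p_int)
  have e_int: "int (nat e) = e"
    using \<open>e > 2\<close> by simp
  have "prime (nat e)"
    using \<open>prime e\<close> prime_nat_int_transfer[of "nat e"] by (simp only: e_int)

  \<comment> \<open>This is the exponent in Euler's criterion: a nonresidue \<open>p\<close> has
    \<open>p ^ k\<close> equal to \<open>-1\<close> modulo \<open>e\<close>, as the descent
    requires.\<close>
  define k where "k = (nat e - 1) div 2"
  have "\<not> e dvd int p"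
  proof
    assume "e dvd int p"
    \<comment> \<open>\<open>QuadRes\<close> counts multiples of \<open>e\<close> as residues, so a
      non-\<open>QuadRes\<close> prime cannot be \<open>e\<close> itself.\<close>
    then have "[0 ^ 2 = int p] (mod e)"
      by (simp add: cong_iff_dvd_diff)
    then have "QuadRes e (int p)"
      unfolding QuadRes_def by blast
    with p'(2) p_int show False by simp
  qed
  then have "Legendre (int p) e = -1"
    using p'(2) p_int by (simp add: Legendre_def cong_0_iff)
  moreover have "[Legendre (int p) (int (nat e)) = int p ^ k] (mod int (nat e))"
    unfolding k_def using \<open>prime (nat e)\<close> \<open>e > 2\<close> by (intro euler_criterion) auto
  ultimately have "[int p ^ k = - 1] (mod e)"
    by (simp only: e_int cong_sym)
  then have "e dvd int (p ^ k + 1)"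
    by (simp add: cong_iff_dvd_diff add.commute)
  then have e_dvd_p: "nat e dvd p ^ k + 1"
    by (metis e_int int_dvd_int_iff)
  have "k > 0"
    using \<open>e > 2\<close> by (simp add: k_def)

  have "coprime e 2"
    using \<open>e mod 4 = 1\<close> unfolding coprime_right_2_iff_odd by presburger
  with e_dvd assms(6) have "e dvd int n"
    using coprime_dvd_mult_right_iff[of e 2 "int n"] by simp
  then have "nat e dvd n"
    by (metis e_int int_dvd_int_iff)
  then obtain m where m: "n = nat e * m" ..
  have "n > 0" using assms(6) by (intro Nat.gr0I) (simp add: add_nonneg_eq_0_iff)
  have "m > 0" using \<open>n > 0\<close> m by (cases m) auto

  have C0: "autocorrelation n a 0 = int n"
  proof -
    have "a i * a i = 1" for i
    proof -
      have "a i = -1 \<or> a i = 1"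
        using a by (simp add: binary_sequence_def)
      then show ?thesis by auto
    qed
    then show ?thesis by (simp add: autocorrelation_def)
  qed
  \<comment> \<open>Among the shifts \<open>t + i * nat e\<close> only \<open>t = i = 0\<close> is
    trivial, with value \<open>n\<close>; all others lie between \<open>1\<close> and
    \<open>n - 1\<close> and contribute \<open>1\<close>. Hence the levels \<open>N = n - 1\<close>
    and \<open>M = m\<close>.\<close>
  have sumC: "(\<Sum>i<m. autocorrelation n a (t + i * nat e)) = (if t = 0 then int n - 1 else 0) + int m"
    if "t < nat e" for t
  proof -
    have C1: "autocorrelation n a (t + i * nat e) = (if t = 0 \<and> i = 0 then int n - 1 else 0) + 1"
      if "i < m" for i
    proof (cases "t = 0 \<and> i = 0")
      case False
      have "t + i * nat e < nat e + i * nat e" using \<open>t < nat e\<close> by simp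
      also have "\<dots> = (i + 1) * nat e" by simp
      also have "\<dots> \<le> m * nat e" using that by (intro mult_right_mono) auto
      finally have "t + i * nat e < n" using m by (simp add: mult.commute)
      moreover have "1 \<le> t + i * nat e" using False \<open>e > 2\<close> by (cases i) auto
      ultimately show ?thesis using False by (simp add: C)
    qed (simp add: C0)
    then have "(\<Sum>i<m. autocorrelation n a (t + i * nat e))
        = (\<Sum>i<m. (if t = 0 \<and> i = 0 then int n - 1 else 0) + 1)"
      by simp
    also have "\<dots> = (if t = 0 then int n - 1 else 0) + int m"
      using \<open>m > 0\<close> by (auto simp: sum.distrib)
    finally show ?thesis .
  qed
  have "\<And>j. a (j + nat e * m) = a j"
    using a m by (simp add: binary_sequence_def)
  note fold = autocorrelation_folded[of a "nat e" m, OF this]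
  define b where "b j = (\<Sum>i<m. a (j + i * nat e))" for j
  have "even (multiplicity (int p) (int n - 1))"
  proof (rule even_multiplicity_if_two_level_autocorrelation[OF p e_dvd_p \<open>k > 0\<close>])
    show "b (i + nat e) = b i" for i
      unfolding b_def by (rule fold(1))
    show "(\<Sum>i<nat e. b i * b (i + t)) = (if t = 0 then int n - 1 else 0) + int m" if "t < nat e" for t
      using fold(2) sumC[OF that] by (simp add: b_def flip: m)
    show "1 < nat e" using \<open>e > 2\<close> by simp
    show "int n - 1 \<noteq> 0" using assms(6) \<open>u ^ 2 \<noteq> 1\<close> by auto
  qed
  with p'(3) p_int show False by simp
qed

end
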